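(* Let $\sigma\ge0$, $a,b,c\in\mathbb{R}$ and $w\in\mathbb{R}^3\setminus\{0\}$, and let $\Omega(\lambda)$ be the $3\times3$ matrix associated with these data defined in the context. There exists a real solution $\lambda$ of the equation $\det\Omega(\lambda)=0$ if and only if $\sigma=0$.
   Context: For $w=(w_1,w_2,w_3)^T\in\mathbb{R}^3\setminus\{0\}$ put $s_w=w_1+w_2+w_3$, $r_w=(w_2-w_3,w_3-w_1,w_1-w_2)^T$, $\nu_w=\sqrt2\,|r_w|/|w|$. The vector $v_{2,w}\in\mathbb{C}^3$ is defined as follows. If $r_w\neq0$, $v_{2,w}=\frac1{\nu_w}\big(\frac{s_w}{|w|^2}w-(1,1,1)^T+\frac{i}{|w|}r_w\big)$. If $r_w=0$, so $w_1=w_2=w_3=\omega$, let $v_2=\frac1{\sqrt3}\big(\frac{1+i\sqrt3}2,\frac{1-i\sqrt3}2,-1\big)^T$ and $v_{2,w}=v_2$ if $\omega\ge0$, $v_{2,w}=\overline{v_2}$ if $\omega<0$. Write $v_{2,w}=(p,q,r)^T$ and set $$\phi=-\frac{i}{|w|}(aw_1+bw_2+cw_3),\qquad\theta=\frac1{|w|}\det\begin{pmatrix}a&b&c\\ w_1&w_2&w_3\\ p&q&r\end{pmatrix},$$ $$\Omega(\lambda)=\begin{pmatrix}i\sigma-\lambda&-\theta\lambda/|w|&\bar\theta\lambda/|w|\\ -|w|\bar\theta&-\lambda^2+i(\sigma+\phi)\lambda+|w|^2&0\\ |w|\theta&0&-\lambda^2+i(\sigma-\phi)\lambda+|w|^2\end{pmatrix}.$$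 The roots of $\det\Omega$ arise as the nonzero eigenvalues for Maxwell's equations with current density $\Sigma E$, $\Sigma=\begin{pmatrix}\sigma&c&-b\\ -c&\sigma&a\\ b&-a&\sigma\end{pmatrix}$, restricted to fields proportional to $e^{ix\cdot w}$. *)

theory Defs
  imports "HOL-Analysis.Analysis"
begin

definition cvec :: "real ^ 3 \<Rightarrow> complex ^ 3" where
  "cvec u = (\<chi> j. complex_of_real (u $ j))"

definition s_of :: "real ^ 3 \<Rightarrow> real" where
  "s_of w = w $ 1 + w $ 2 + w $ 3"

definition r_of :: "real ^ 3 \<Rightarrow> real ^ 3" where
  "r_of w = vector [w $ 2 - w $ 3, w $ 3 - w $ 1, w $ 1 - w $ 2]"

definition nu_of :: "real ^ 3 \<Rightarrow> real" where
  "nu_of w = sqrt 2 * norm (r_of w) / norm w"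

definition v2 :: "complex ^ 3" where
  "v2 = (1 / complex_of_real (sqrt 3)) *s
     vector [(1 + \<i> * complex_of_real (sqrt 3)) / 2,
             (1 - \<i> * complex_of_real (sqrt 3)) / 2, -1]"

text \<open>If \<^term>\<open>r_of w = 0\<close>, then all components of \<^term>\<open>w\<close> coincide, so that
  testing the sign of the first one is testing the sign of their common value.\<close>

definition v2_of :: "real ^ 3 \<Rightarrow> complex ^ 3" where
  "v2_of w =
    (if r_of w \<noteq> 0 then
       complex_of_real (1 / nu_of w) *s
         (complex_of_real (s_of w / (norm w)\<^sup>2) *s cvec w - vector [1, 1, 1]
          + (\<i> / complex_of_real (norm w)) *s cvec (r_of w))
     else if w $ 1 \<ge> 0 then v2
     else (\<chi> j. cnj (v2 $ j)))"

definition phi :: "real \<Rightarrow> real \<Rightarrow> real \<Rightarrow> real ^ 3 \<Rightarrow> complex" where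
  "phi a b c w =
     - (\<i> / complex_of_real (norm w)) * complex_of_real (a * w $ 1 + b * w $ 2 + c * w $ 3)"

definition theta :: "real \<Rightarrow> real \<Rightarrow> real \<Rightarrow> real ^ 3 \<Rightarrow> complex" where
  "theta a b c w =
     1 / complex_of_real (norm w) *
     det (vector [cvec (vector [a, b, c]), cvec w, v2_of w] :: complex ^ 3 ^ 3)"

definition Omega ::
  "real \<Rightarrow> real \<Rightarrow> real \<Rightarrow> real \<Rightarrow> real ^ 3 \<Rightarrow> complex \<Rightarrow> complex ^ 3 ^ 3" where
  "Omega \<sigma> a b c w z =
    (let n = complex_of_real (norm w);
         s = complex_of_real \<sigma>;
         \<phi> = phi a b c w;
         \<theta> = theta a b c w
     in vector
       [vector [\<i> * s - z, - \<theta> * z / n, cnj \<theta> * z / n],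
        vector [- n * cnj \<theta>, - (z\<^sup>2) + \<i> * (s + \<phi>) * z + n\<^sup>2, 0],
        vector [n * \<theta>, 0, - (z\<^sup>2) + \<i> * (s - \<phi>) * z + n\<^sup>2]])"

end

theory Submission
  imports Defs
begin

text \<open>
  Write \<open>n = |w|\<close>, \<open>T = |\<theta>|\<^sup>2\<close>, and \<open>\<phi> = - \<i> t\<close> with \<open>t\<close> real. With
  \<open>P = n\<^sup>2 - \<lambda>\<^sup>2\<close> and \<open>Q = P + \<i> \<sigma> \<lambda>\<close>, the lower diagonal entries are \<open>Q \<plusminus> t \<lambda>\<close>, and the
  determinant collapses to \<open>(\<i> \<sigma> - \<lambda>) (Q\<^sup>2 - t\<^sup>2 \<lambda>\<^sup>2) - 2 T \<lambda> Q\<close> (lemma \<open>det_Omega\<close>).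
  The sign \<open>T \<ge> 0\<close> is what makes the following estimate work.

  If \<open>\<sigma> = 0\<close>, then \<open>\<lambda> = 0\<close> is a root. If \<open>\<sigma> > 0\<close>, then \<open>\<lambda> = 0\<close> is not a root, and for real
  \<open>\<lambda> \<noteq> 0\<close> the real and the imaginary part of the equation give two expressions for the same
  number \<open>R = P\<^sup>2 - \<sigma>\<^sup>2 \<lambda>\<^sup>2 - t\<^sup>2 \<lambda>\<^sup>2\<close>, namely
  \<open>R = - 2 P (\<sigma>\<^sup>2 + T)\<close> and \<open>R = 2 \<lambda>\<^sup>2 (P + T)\<close>. Equating them places \<open>P\<close> in \<open>[-T, 0]\<close>, whereas the
  first one says that \<open>P (P + 2 (\<sigma>\<^sup>2 + T)) = (\<sigma>\<^sup>2 + t\<^sup>2) \<lambda>\<^sup>2 > 0\<close>, which for \<open>P \<le> 0\<close> forces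
  \<open>P < - 2 (\<sigma>\<^sup>2 + T) < - T\<close>, a contradiction.
\<close>

text \<open>The two zero entries leave only the products \<open>\<theta> cnj \<theta>\<close> of opposite
  off-diagonal entries, so the phase of \<open>\<theta>\<close> drops out; and as the two lower diagonal entries are
  \<open>Q \<plusminus> t z\<close>, the first powers of \<open>t\<close> cancel.\<close>

lemma det_Omega:
  fixes \<sigma> a b c :: real and w :: "real ^ 3" and z :: complex
  defines "n \<equiv> complex_of_real (norm w)"
    and "t \<equiv> complex_of_real ((a * w $ 1 + b * w $ 2 + c * w $ 3) / norm w)"
    and "T \<equiv> complex_of_real ((cmod (theta a b c w))\<^sup>2)"
  defines "Q \<equiv> n\<^sup>2 - z\<^sup>2 + \<i> * complex_of_real \<sigma> * z"
  assumes "w \<noteq> 0"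
  shows "det (Omega \<sigma> a b c w z) =
    (\<i> * complex_of_real \<sigma> - z) * (Q\<^sup>2 - t\<^sup>2 * z\<^sup>2) - 2 * T * z * Q"
proof -
  define \<theta> where "\<theta> = theta a b c w"
  have n0: "n \<noteq> 0" using assms by (simp add: n_def)
  have \<phi>: "phi a b c w = - (\<i> * t)"
    by (simp add: phi_def t_def)
  have T: "T = \<theta> * cnj \<theta>"
    unfolding T_def \<theta>_def complex_norm_square ..
  have D: "- (z\<^sup>2) + \<i> * (complex_of_real \<sigma> + - (\<i> * t)) * z + n\<^sup>2 = Q + t * z"
    "- (z\<^sup>2) + \<i> * (complex_of_real \<sigma> - - (\<i> * t)) * z + n\<^sup>2 = Q - t * z"
    by (simp_all add: Q_def algebra_simps)
  have "det (Omega \<sigma> a b c w z) =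
      (\<i> * complex_of_real \<sigma> - z) * (Q + t * z) * (Q - t * z)
      - (\<theta> * cnj \<theta>) * z * (Q - t * z) - (\<theta> * cnj \<theta>) * z * (Q + t * z)"
    unfolding Omega_def Let_def n_def[symmetric] \<phi> \<theta>_def[symmetric] D
    using n0 by (simp add: det_3)
  also have "\<dots> = (\<i> * complex_of_real \<sigma> - z) * (Q\<^sup>2 - t\<^sup>2 * z\<^sup>2) - 2 * T * z * Q"
    unfolding T by (simp add: algebra_simps power2_eq_square)
  finally show ?thesis .
qed

text \<open>The two equations are the real and the imaginary part of the characteristic equation at
  \<open>\<lambda> = x\<close>, with the respective nonzero factors \<open>-x\<close> and \<open>\<sigma>\<close> removed. Their difference
  is linear in \<open>P\<close>, with solution \<open>P = - T x\<^sup>2 / (\<sigma>\<^sup>2 + T + x\<^sup>2)\<close>; the fraction multiplying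
  \<open>- T\<close> lies in \<open>[0, 1]\<close>, so \<open>P\<close> is too close to zero for the first equation.\<close>

lemma no_common_real_solution:
  fixes P T t x \<sigma> :: real
  assumes "T \<ge> 0" "\<sigma> \<noteq> 0" "x \<noteq> 0"
    and re: "P\<^sup>2 - \<sigma>\<^sup>2 * x\<^sup>2 - t\<^sup>2 * x\<^sup>2 = - 2 * P * (\<sigma>\<^sup>2 + T)"
    and im: "P\<^sup>2 - \<sigma>\<^sup>2 * x\<^sup>2 - t\<^sup>2 * x\<^sup>2 = 2 * x\<^sup>2 * (P + T)"
  shows False
proof -
  have \<sigma>2: "\<sigma>\<^sup>2 > 0" and x2: "x\<^sup>2 > 0"
    using \<open>\<sigma> \<noteq> 0\<close> \<open>x \<noteq> 0\<close> by simp_all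
  \<comment> \<open>the coefficient of \<open>P\<close> in the linear equation\<close>
  define S where "S = \<sigma>\<^sup>2 + T + x\<^sup>2"
  have S: "S > 0" using \<sigma>2 x2 \<open>T \<ge> 0\<close> unfolding S_def by linarith
  have PS: "P * S = - (x\<^sup>2 * T)"
  proof -
    have "P * (\<sigma>\<^sup>2 + T) + x\<^sup>2 * (P + T) = 0"
      using re im by linarith
    then show ?thesis unfolding S_def by (simp add: distrib_left mult.commute[of "x\<^sup>2"])
  qed
  have "P * S \<le> 0" using PS \<open>T \<ge> 0\<close> by simp
  then have P0: "P \<le> 0" using S by (simp add: mult_le_0_iff)
  have "(P + T) * S = T * (\<sigma>\<^sup>2 + T)"
    using PS by (simp add: S_def algebra_simps)
  also have "\<dots> \<ge> 0" using \<open>T \<ge> 0\<close> \<sigma>2 by simp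
  finally have PT: "P + T \<ge> 0" using S by (simp add: zero_le_mult_iff)
  have "P * (P + 2 * (\<sigma>\<^sup>2 + T)) = (\<sigma>\<^sup>2 + t\<^sup>2) * x\<^sup>2"
  proof -
    have "P * (P + 2 * (\<sigma>\<^sup>2 + T)) = P\<^sup>2 - (- 2 * P * (\<sigma>\<^sup>2 + T))"
      by (simp add: algebra_simps power2_eq_square)
    also have "\<dots> = (\<sigma>\<^sup>2 + t\<^sup>2) * x\<^sup>2"
      unfolding re[symmetric] by (simp add: algebra_simps)
    finally show ?thesis .
  qed
  also have "\<dots> > 0" using \<sigma>2 x2 by (simp add: add_pos_nonneg)
  finally have "P * (P + 2 * (\<sigma>\<^sup>2 + T)) > 0" .
  moreover have "P * (P + 2 * (\<sigma>\<^sup>2 + T)) \<le> 0"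
  proof (rule mult_nonpos_nonneg[OF P0])
    have "P + 2 * (\<sigma>\<^sup>2 + T) = (P + T) + (T + 2 * \<sigma>\<^sup>2)" by simp
    also have "\<dots> \<ge> 0" using \<open>T \<ge> 0\<close> by (intro add_nonneg_nonneg[OF PT]) simp
    finally show "0 \<le> P + 2 * (\<sigma>\<^sup>2 + T)" .
  qed
  ultimately show False by simp
qed

lemma det_Omega_real_root_imp_no_conductivity:
  fixes \<sigma> a b c x :: real and w :: "real ^ 3"
  assumes "w \<noteq> 0" and root: "det (Omega \<sigma> a b c w (complex_of_real x)) = 0"
  shows "\<sigma> = 0"
proof (rule ccontr)
  assume \<sigma>: "\<sigma> \<noteq> 0"
  define t where "t = (a * w $ 1 + b * w $ 2 + c * w $ 3) / norm w"
  define T where "T = (cmod (theta a b c w))\<^sup>2"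
  define P where "P = (norm w)\<^sup>2 - x\<^sup>2"
  define R where "R = P\<^sup>2 - \<sigma>\<^sup>2 * x\<^sup>2 - t\<^sup>2 * x\<^sup>2"
  have det: "det (Omega \<sigma> a b c w (complex_of_real x)) =
      Complex (- x * (2 * P * \<sigma>\<^sup>2 + R + 2 * T * P))
              (\<sigma> * (R - 2 * x\<^sup>2 * (P + T)))"
    unfolding det_Omega[OF \<open>w \<noteq> 0\<close>] t_def[symmetric] T_def[symmetric] R_def P_def
    by (simp add: complex_eq_iff power2_eq_square algebra_simps)
  have "- x * (2 * P * \<sigma>\<^sup>2 + R + 2 * T * P) = 0"
    using root unfolding det complex_eq_iff complex.sel zero_complex.sel by (rule conjunct1)
  then have re: "x = 0 \<or> 2 * P * \<sigma>\<^sup>2 + R + 2 * T * P = 0"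
    by (simp only: mult_eq_0_iff neg_equal_0_iff_equal)
  have "\<sigma> * (R - 2 * x\<^sup>2 * (P + T)) = 0"
    using root unfolding det complex_eq_iff complex.sel zero_complex.sel by (rule conjunct2)
  then have im: "R - 2 * x\<^sup>2 * (P + T) = 0"
    using \<sigma> by (simp only: mult_eq_0_iff simp_thms)
  have x: "x \<noteq> 0"
  proof
    assume "x = 0"
    then have "(norm w)\<^sup>2 = 0" using im by (simp add: R_def P_def)
    with \<open>w \<noteq> 0\<close> show False by simp
  qed
  have re': "R = - 2 * P * (\<sigma>\<^sup>2 + T)"
    using re x by (simp add: algebra_simps)
  have im': "R = 2 * x\<^sup>2 * (P + T)"
    using im by linarith
  show False
    using no_common_real_solution[OF _ \<sigma> x re'[unfolded R_def] im'[unfolded R_def]]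
    by (simp add: T_def)
qed

theorem proposition4p3:
  fixes \<sigma> a b c :: real and w :: "real ^ 3"
  assumes "\<sigma> \<ge> 0" and "w \<noteq> 0"
  shows "(\<exists>x::real. det (Omega \<sigma> a b c w (complex_of_real x)) = 0) \<longleftrightarrow> \<sigma> = 0"
proof
  assume "\<exists>x::real. det (Omega \<sigma> a b c w (complex_of_real x)) = 0"
  then show "\<sigma> = 0"
    using det_Omega_real_root_imp_no_conductivity[OF \<open>w \<noteq> 0\<close>] by blast
next
  assume "\<sigma> = 0"
  then have "det (Omega \<sigma> a b c w (complex_of_real 0)) = 0"
    by (simp add: det_Omega[OF \<open>w \<noteq> 0\<close>])
  then show "\<exists>x::real. det (Omega \<sigma> a b c w (complex_of_real x)) = 0" ..
qed

end
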